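(* $T'\subseteq DBQREL\circ T$, and $ZT'\subseteq DBQREL\circ ZT$ for $Z\in\{L,D,LD\}$; that is, every top-down tree transformation with regular look-ahead is a deterministic bottom-up finite state relabeling followed by an (ordinary) top-down tree transformation, and the same holds with both the top-down$'$ and the top-down transformation restricted to be linear, deterministic, or linear deterministic.
   Context: Alphabets are finite. A ranked alphabet $\Sigma$ is a finite set of symbols with, for each $k\ge 0$, a subset $\Sigma_k$ (symbols of rank $k$; a symbol may have several ranks), $\Sigma=\bigcup_k\Sigma_k$, only finitely many $\Sigma_k$ nonempty. $T_\Sigma$ is the set of trees over $\Sigma$: $a\in T_\Sigma$ for $a\in\Sigma_0$, and $a[t_1\cdots t_k]\in T_\Sigma$ for $k\ge1$, $a\in\Sigma_k$, $t_i\in T_\Sigma$. For a set $S$ of trees or of new symbols (regarded as having rank $0$), $T_\Sigma(S)$ is the smallest set containing $S\cup\Sigma_0$ and closed under $(t_1,\dots,t_k)\mapsto a[t_1\cdots t_k]$ for $k\ge1$, $a\in\Sigma_k$. A tree transformation from $T_\Sigma$ into $T_\Delta$ is a subset of $T_\Sigma\times T_\Delta$. $M_1\circ M_2=\{(s,t)\mid (s,u)\in M_1,(u,t)\in M_2\text{ for some }u\}$ for $M_1\subseteq T_\Sigma\times T_\Delta$, $M_2\subseteq T_\Delta\times T_\Omega$ ($M_1$ applied first); $F\circ G=\{M_1\circ M_2\mid M_1\in F,M_2\in G\}$. Variables: $X_k=\{x_1,\dots,x_k\}$. $L\subseteq T_\Sigma$ is recognizable if $L=\{t\in T_\Sigma\mid\widehat\delta(t)\in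 F\}$ for some finite set $Q$, $F\subseteq Q$, $s_a\in Q$ ($a\in\Sigma_0$), $\delta_a^k:Q^k\to Q$ ($k\ge1,a\in\Sigma_k$), where $\widehat\delta(a)=s_a$, $\widehat\delta(a[t_1\cdots t_k])=\delta_a^k(\widehat\delta(t_1),\dots,\widehat\delta(t_k))$. State sets $Q$ of transducers are finite, states are regarded as symbols of rank $1$ only, disjoint from input alphabet $\Sigma$ and output alphabet $\Delta$; $Q[X_k]=\{q[x]\mid q\in Q,x\in X_k\}$. A rule $v\to w$ in which each variable $x_i$ has a prescribed range rewrites trees over $Q\cup\Sigma\cup\Delta$: $s\Rightarrow s'$ if $s'$ arises from $s$ by replacing one occurrence of a subtree $v\langle x_1\gets\phi_1,\dots,x_k\gets\phi_k\rangle$ by $w\langle x_1\gets\phi_1,\dots,x_k\gets\phi_k\rangle$ with each $\phi_i$ in the range of $x_i$ (simultaneous substitution). A top-down finite tree transducer with regular look-ahead (top-down$'$) is $M=(Q,\Sigma,\Delta,R,Q_d)$, $Q_d\subseteq Q$ (initial states), $R$ a finite set of rules $(v\to w,D)$, where $v\to w$ has the form $q[a[x_1\cdots x_k]]\to t$ ($k\ge1$, $a\in\Sigma_k$, $q\in Q$, $t\in T_\Delta(Q[X_k])$) or $q[a]\to t$ ($a\in\Sigma_0$, $t\in T_\Delta$), and $D$ assigns to each $x_i$, $1\le i\le k$, a recognizable range $D(x_i)\subseteq T_\Sigma$. $M$ realizes $\{(s,t)\in T_\Sigma\times T_\Delta\mid q[s]\Rightarrow^*t\text{ for some }q\in Q_d\}$.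 It is linear (letter $L$) if no variable occurs more than once in the right hand side of a rule; deterministic (letter $D$) if $Q_d$ is a singleton and for any two different rules $(s\to t_1,D_1),(s\to t_2,D_2)$ with the same left hand side, $D_1(x_i)\cap D_2(x_i)=\emptyset$ for some $i$. A(n ordinary) top-down finite tree transducer is defined in the same way but with all ranges equal to $T_\Sigma$ (no look-ahead); it is deterministic if $Q_d$ is a singleton and different rules have different left hand sides; linearity is the same. $T'$ (resp. $T$) is the class of transformations realized by top-down$'$ (resp. top-down) transducers, with prefixes $L$, $D$, $LD$ for linear, deterministic, both. $DBQREL$: transformations realized by $(Q,\Sigma,\Delta,R,Q_d)$, $Q_d\subseteq Q$ (final states), $R$ a finite set of rules $a[q_1[x_1]\cdots q_k[x_k]]\to q[b[x_1\cdots x_k]]$ ($k\ge1$, $a\in\Sigma_k,b\in\Delta_k$) or $a\to q[b]$ ($a\in\Sigma_0,b\in\Delta_0$), different rules having different left hand sides, variables ranging over $T_\Delta$; the realized transformation is $\{(s,t)\in T_\Sigma\times T_\Delta\mid s\Rightarrow^*q[t],\ q\in Q_d\}$. *)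

theory Defs
  imports Main "HOL-Library.Infinite_Typeclass"
begin

text \<open>
  All symbols (of input alphabets, output alphabets and state sets) are drawn from one type
  \<open>'a\<close>.  The rank of an occurrence of a symbol is its number of sons, so one symbol may have
  several ranks.  A leaf \<open>a\<close> is \<open>Node a []\<close>; variables are a separate constructor, hence
  distinct from all symbols, and are numbered from 0: \<open>Var i\<close> stands for
  $x_{i+1}$.
\<close>

datatype 'a tree = Var nat | Node 'a "'a tree list"

text \<open>A ranked alphabet is given by its sets of symbols of rank \<open>k\<close>.\<close>

type_synonym 'a ralphabet = "nat \<Rightarrow> 'a set"

definition symbols :: "'a ralphabet \<Rightarrow> 'a set" where
  "symbols \<Sigma> = (\<Union>k. \<Sigma> k)"

definition ranked_alphabet :: "'a ralphabet \<Rightarrow> bool" where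
  "ranked_alphabet \<Sigma> \<longleftrightarrow> finite (symbols \<Sigma>) \<and> finite {k. \<Sigma> k \<noteq> {}}"

inductive_set trees_over :: "'a ralphabet \<Rightarrow> 'a tree set \<Rightarrow> 'a tree set"
  for \<Sigma> :: "'a ralphabet" and S :: "'a tree set" where
  base: "t \<in> S \<Longrightarrow> t \<in> trees_over \<Sigma> S"
| leaf: "a \<in> \<Sigma> 0 \<Longrightarrow> Node a [] \<in> trees_over \<Sigma> S"
| node: "ts \<noteq> [] \<Longrightarrow> a \<in> \<Sigma> (length ts) \<Longrightarrow> (\<And>t. t \<in> set ts \<Longrightarrow> t \<in> trees_over \<Sigma> S)
           \<Longrightarrow> Node a ts \<in> trees_over \<Sigma> S"

definition trees :: "'a ralphabet \<Rightarrow> 'a tree set" where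
  "trees \<Sigma> = trees_over \<Sigma> {}"


subsection \<open>Recognizable tree languages\<close>

text \<open>
  \<open>\<delta> a []\<close> is the state $s_a$ and \<open>\<delta> a [q\<^sub>1, \<dots>, q\<^sub>k]\<close> is $\delta_a^k(q_1,\dots,q_k)$.  The value on
  variables is irrelevant, since they do not occur in trees over \<open>\<Sigma>\<close>.
\<close>

fun run :: "('a \<Rightarrow> 'q list \<Rightarrow> 'q) \<Rightarrow> 'a tree \<Rightarrow> 'q" where
  "run \<delta> (Var i) = undefined"
| "run \<delta> (Node a ts) = \<delta> a (map (run \<delta>) ts)"

text \<open>Taking natural numbers as states is no restriction, state sets being finite.\<close>

definition recognizable :: "'a ralphabet \<Rightarrow> 'a tree set \<Rightarrow> bool" where
  "recognizable \<Sigma> L \<longleftrightarrow>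
     (\<exists>(Q :: nat set) F \<delta>. finite Q \<and> F \<subseteq> Q \<and>
        (\<forall>a qs. a \<in> \<Sigma> (length qs) \<and> set qs \<subseteq> Q \<longrightarrow> \<delta> a qs \<in> Q) \<and>
        L = {t \<in> trees \<Sigma>. run \<delta> t \<in> F})"


subsection \<open>Rules and rewriting\<close>

text \<open>
  \<open>ranges\<close> lists the ranges of the variables \<open>Var 0, \<dots>, Var (k - 1)\<close> of a rule, where \<open>k\<close> is the
  length of the list.
\<close>

record 'a rule =
  lhs :: "'a tree"
  rhs :: "'a tree"
  ranges :: "'a tree set list"

primrec subst :: "(nat \<Rightarrow> 'a tree) \<Rightarrow> 'a tree \<Rightarrow> 'a tree" where
  "subst \<phi> (Var i) = \<phi> i"
| "subst \<phi> (Node a ts) = Node a (map (subst \<phi>) ts)"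

inductive step :: "'a rule set \<Rightarrow> 'a tree \<Rightarrow> 'a tree \<Rightarrow> bool" for R :: "'a rule set" where
  root: "r \<in> R \<Longrightarrow> (\<And>i. i < length (ranges r) \<Longrightarrow> \<phi> i \<in> ranges r ! i)
           \<Longrightarrow> step R (subst \<phi> (lhs r)) (subst \<phi> (rhs r))"
| inner: "step R t t' \<Longrightarrow> step R (Node a (us @ t # vs)) (Node a (us @ t' # vs))"

primrec var_occs :: "'a tree \<Rightarrow> nat list" where
  "var_occs (Var i) = [i]"
| "var_occs (Node a ts) = concat (map var_occs ts)"


subsection \<open>Transducers\<close>

text \<open>
  \<open>designated\<close> is the set $Q_d$: the initial states of a top-down transducer, the final states of a
  bottom-up relabeling.
\<close>

record 'a transducer =
  states :: "'a set"
  inp :: "'a ralphabet"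
  out :: "'a ralphabet"
  rules :: "'a rule set"
  designated :: "'a set"

definition transducer_base :: "'a transducer \<Rightarrow> bool" where
  "transducer_base M \<longleftrightarrow>
     ranked_alphabet (inp M) \<and> ranked_alphabet (out M) \<and>
     finite (states M) \<and> states M \<inter> symbols (inp M) = {} \<and> states M \<inter> symbols (out M) = {} \<and>
     finite (rules M) \<and> designated M \<subseteq> states M"

text \<open>The case \<open>k = 0\<close> is the rule form $q[a] \to t$ with $t \in T_\Delta$.\<close>

definition topdown_la_rule :: "'a set \<Rightarrow> 'a ralphabet \<Rightarrow> 'a ralphabet \<Rightarrow> 'a rule \<Rightarrow> bool" where
  "topdown_la_rule Q \<Sigma> \<Delta> r \<longleftrightarrow>
     (\<exists>q a k. q \<in> Q \<and> a \<in> \<Sigma> k \<and>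
        lhs r = Node q [Node a (map Var [0..<k])] \<and>
        rhs r \<in> trees_over \<Delta> {Node p [Var i] |p i. p \<in> Q \<and> i < k} \<and>
        length (ranges r) = k \<and> (\<forall>L \<in> set (ranges r). recognizable \<Sigma> L))"

definition topdown_la :: "'a transducer \<Rightarrow> bool" where
  "topdown_la M \<longleftrightarrow> transducer_base M \<and>
     (\<forall>r \<in> rules M. topdown_la_rule (states M) (inp M) (out M) r)"

definition topdown :: "'a transducer \<Rightarrow> bool" where
  "topdown M \<longleftrightarrow> topdown_la M \<and> (\<forall>r \<in> rules M. \<forall>L \<in> set (ranges r). L = trees (inp M))"

definition linear :: "'a transducer \<Rightarrow> bool" where
  "linear M \<longleftrightarrow> (\<forall>r \<in> rules M. distinct (var_occs (rhs r)))"

text \<open>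
  Rules with equal left hand sides have equally many variables, so the index \<open>i\<close> below is in bounds
  for both rules.
\<close>

definition deterministic_la :: "'a transducer \<Rightarrow> bool" where
  "deterministic_la M \<longleftrightarrow> is_singleton (designated M) \<and>
     (\<forall>r1 \<in> rules M. \<forall>r2 \<in> rules M. r1 \<noteq> r2 \<and> lhs r1 = lhs r2 \<longrightarrow>
        (\<exists>i < length (ranges r1). ranges r1 ! i \<inter> ranges r2 ! i = {}))"

definition distinct_lhs :: "'a rule set \<Rightarrow> bool" where
  "distinct_lhs R \<longleftrightarrow> (\<forall>r1 \<in> R. \<forall>r2 \<in> R. r1 \<noteq> r2 \<longrightarrow> lhs r1 \<noteq> lhs r2)"

definition deterministic :: "'a transducer \<Rightarrow> bool" where
  "deterministic M \<longleftrightarrow> is_singleton (designated M) \<and> distinct_lhs (rules M)"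

text \<open>The case \<open>k = 0\<close> is the rule form $a \to q[b]$.\<close>

definition dbqrel_rule :: "'a set \<Rightarrow> 'a ralphabet \<Rightarrow> 'a ralphabet \<Rightarrow> 'a rule \<Rightarrow> bool" where
  "dbqrel_rule Q \<Sigma> \<Delta> r \<longleftrightarrow>
     (\<exists>a b q k qs. a \<in> \<Sigma> k \<and> b \<in> \<Delta> k \<and> q \<in> Q \<and> length qs = k \<and> set qs \<subseteq> Q \<and>
        lhs r = Node a (map (\<lambda>i. Node (qs ! i) [Var i]) [0..<k]) \<and>
        rhs r = Node q [Node b (map Var [0..<k])] \<and>
        ranges r = replicate k (trees \<Delta>))"

definition dbqrel :: "'a transducer \<Rightarrow> bool" where
  "dbqrel M \<longleftrightarrow> transducer_base M \<and>
     (\<forall>r \<in> rules M. dbqrel_rule (states M) (inp M) (out M) r) \<and> distinct_lhs (rules M)"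


subsection \<open>Tree transformations and their classes\<close>

text \<open>
  A transformation carries its input and output alphabet, so that composition is only formed when
  the middle alphabets agree.
\<close>

type_synonym 'a transformation = "'a ralphabet \<times> 'a ralphabet \<times> ('a tree \<times> 'a tree) set"

definition topdown_transformation :: "'a transducer \<Rightarrow> 'a transformation" where
  "topdown_transformation M = (inp M, out M,
     {(s, t). s \<in> trees (inp M) \<and> t \<in> trees (out M) \<and>
        (\<exists>q \<in> designated M. (step (rules M))\<^sup>*\<^sup>* (Node q [s]) t)})"

definition bottomup_transformation :: "'a transducer \<Rightarrow> 'a transformation" where
  "bottomup_transformation M = (inp M, out M,
     {(s, t). s \<in> trees (inp M) \<and> t \<in> trees (out M) \<and>
        (\<exists>q \<in> designated M. (step (rules M))\<^sup>*\<^sup>* s (Node q [t]))})"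

text \<open>\<open>O\<close> is relation composition with the left relation applied first.\<close>

definition class_comp ::
  "'a transformation set \<Rightarrow> 'a transformation set \<Rightarrow> 'a transformation set"  (infixr \<open>\<circ>\<^sub>C\<close> 75) where
  "F \<circ>\<^sub>C G = {(\<Sigma>, \<Omega>, M1 O M2) |\<Sigma> \<Delta> \<Omega> M1 M2. (\<Sigma>, \<Delta>, M1) \<in> F \<and> (\<Delta>, \<Omega>, M2) \<in> G}"

definition DBQREL :: "'a transformation set" where
  "DBQREL = {bottomup_transformation M |M. dbqrel M}"

definition T_la :: "'a transformation set" where
  "T_la = {topdown_transformation M |M. topdown_la M}"

definition LT_la :: "'a transformation set" where
  "LT_la = {topdown_transformation M |M. topdown_la M \<and> linear M}"

definition DT_la :: "'a transformation set" where
  "DT_la = {topdown_transformation M |M. topdown_la M \<and> deterministic_la M}"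

definition LDT_la :: "'a transformation set" where
  "LDT_la = {topdown_transformation M |M. topdown_la M \<and> linear M \<and> deterministic_la M}"

definition T :: "'a transformation set" where
  "T = {topdown_transformation M |M. topdown M}"

definition LT :: "'a transformation set" where
  "LT = {topdown_transformation M |M. topdown M \<and> linear M}"

definition DT :: "'a transformation set" where
  "DT = {topdown_transformation M |M. topdown M \<and> deterministic M}"

definition LDT :: "'a transformation set" where
  "LDT = {topdown_transformation M |M. topdown M \<and> linear M \<and> deterministic M}"

end

theory Submission
  imports Defs "HOL-Library.Nat_Bijection"
begin

text \<open>
  The look-ahead languages of the transducer are finitely many, so a single deterministic bottom-up
  automaton recognizes all of them.  The relabeling attaches to every node, besides its old label,
  the states which that automaton reaches at the sons; a top-down transducer reading the relabeled
  tree can then check the look-ahead conditions of a rule on the label alone.  Only reachable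
  states are used: this is what turns disjointness of the look-ahead languages into determinism of
  the new transducer.
\<close>

section \<open>Trees and rewriting\<close>

lemma Node_in_trees_iff [simp]:
  "Node a ts \<in> trees \<Sigma> \<longleftrightarrow> a \<in> \<Sigma> (length ts) \<and> set ts \<subseteq> trees \<Sigma>"
proof
  assume "Node a ts \<in> trees \<Sigma>"
  then show "a \<in> \<Sigma> (length ts) \<and> set ts \<subseteq> trees \<Sigma>"
    unfolding trees_def by cases auto
next
  assume "a \<in> \<Sigma> (length ts) \<and> set ts \<subseteq> trees \<Sigma>"
  then show "Node a ts \<in> trees \<Sigma>"
    unfolding trees_def by (cases "ts = []") (auto intro: trees_over.leaf trees_over.node)
qed

lemma Var_notin_trees [simp]: "Var i \<notin> trees \<Sigma>"
  unfolding trees_def by (auto elim: trees_over.cases)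

lemma trees_induct [consumes 1, case_names Node]:
  assumes "t \<in> trees \<Sigma>"
    and "\<And>a ts. a \<in> \<Sigma> (length ts) \<Longrightarrow> set ts \<subseteq> trees \<Sigma> \<Longrightarrow> (\<And>t. t \<in> set ts \<Longrightarrow> P t) \<Longrightarrow> P (Node a ts)"
  shows "P t"
  using assms(1)
proof (induction t)
  case (Var i)
  then show ?case by simp
next
  case (Node a ts)
  then show ?case by (intro assms(2)) auto
qed

lemma in_symbols: "a \<in> \<Sigma> k \<Longrightarrow> a \<in> symbols \<Sigma>"
  by (auto simp: symbols_def)

lemma labels_trees: "t \<in> trees \<Sigma> \<Longrightarrow> set_tree t \<subseteq> symbols \<Sigma>"
  by (induction rule: trees_induct) (auto dest: in_symbols)

lemma recognizable_trees: "recognizable \<Sigma> (trees \<Sigma>)"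
  unfolding recognizable_def
proof (intro exI[of _ "{0}"] exI[of _ "\<lambda>a qs. 0"] conjI)
  show "trees \<Sigma> = {t \<in> trees \<Sigma>. run (\<lambda>a qs. 0) t \<in> {0::nat}}"
    by (auto elim: trees_induct)
qed auto

lemma step_NodeE:
  assumes "step R (Node a ts) u"
  obtains (root) r \<phi> where "r \<in> R" "\<And>i. i < length (ranges r) \<Longrightarrow> \<phi> i \<in> ranges r ! i"
      "Node a ts = subst \<phi> (lhs r)" "u = subst \<phi> (rhs r)"
    | (inner) us t t' vs where "ts = us @ t # vs" "u = Node a (us @ t' # vs)" "step R t t'"
  using assms by cases auto

text \<open>A redex has a symbol of \<open>Q\<close> at its root, because substitution keeps the
  root label of a left-hand side.\<close>

lemma irreducible:
  assumes "\<And>r. r \<in> R \<Longrightarrow> \<exists>q ts. lhs r = Node q ts \<and> q \<in> Q" and "set_tree t \<inter> Q = {}"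
  shows "\<not> step R t u"
proof
  assume "step R t u"
  then show False using assms(2)
  proof (induction rule: step.induct)
    case (root r \<phi>)
    then show ?case using assms(1)[of r] by auto
  qed auto
qed

lemma steps_inner:
  "(step R)\<^sup>*\<^sup>* t t' \<Longrightarrow> (step R)\<^sup>*\<^sup>* (Node a (us @ t # vs)) (Node a (us @ t' # vs))"
  by (induction rule: rtranclp_induct) (auto intro: rtranclp.rtrancl_into_rtrancl step.inner)

lemma steps_sons:
  assumes "list_all2 (step R)\<^sup>*\<^sup>* ts us"
  shows "(step R)\<^sup>*\<^sup>* (Node a (vs @ ts)) (Node a (vs @ us))"
  using assms
\<comment> \<open>Generalizing over \<open>vs\<close> lets the sons already rewritten move into the
  prefix.\<close>
proof (induction arbitrary: vs rule: list_all2_induct)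
  case (Cons t ts u us)
  have "(step R)\<^sup>*\<^sup>* (Node a (vs @ t # ts)) (Node a (vs @ u # ts))"
    by (rule steps_inner) fact
  also have "(step R)\<^sup>*\<^sup>* (Node a (vs @ u # ts)) (Node a (vs @ u # us))"
    using Cons.IH[of "vs @ [u]"] by simp
  finally show ?case .
qed simp

section \<open>Simulation of top-down derivations\<close>

text \<open>An intermediate tree of a top-down derivation is an output context with calls
  \<open>q[s]\<close> hanging from it. \<open>sim\<close> keeps context and states equal and lets
  only the pending inputs differ, as prescribed by \<open>H\<close>. Excluding \<open>Q\<close> in
  \<open>node\<close> prevents a call from being read as output.\<close>

inductive sim :: "'a set \<Rightarrow> ('a tree \<Rightarrow> 'a tree \<Rightarrow> bool) \<Rightarrow> 'a tree \<Rightarrow> 'a tree \<Rightarrow> bool"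
  for Q H where
  call: "q \<in> Q \<Longrightarrow> H s s' \<Longrightarrow> sim Q H (Node q [s]) (Node q [s'])"
| node: "b \<notin> Q \<Longrightarrow> list_all2 (sim Q H) us us' \<Longrightarrow> sim Q H (Node b us) (Node b us')"

text \<open>Without states the clause \<open>call\<close> cannot occur, so only the common output
  context remains.\<close>

lemma sim_eq:
  assumes "sim Q H t t'" and "set_tree t \<inter> Q = {}"
  shows "t = t'"
  using assms
proof (induction rule: sim.induct)
  case (node b us us')
  have "us = us'"
  proof (rule nth_equalityI)
    show "length us = length us'" using node.IH by (simp add: list_all2_lengthD)
    show "us ! i = us' ! i" if "i < length us" for i
    proof -
      have "set_tree (us ! i) \<inter> Q = {}" using node.prems nth_mem[OF that] by fastforce
      then show ?thesis using node.IH that by (simp add: list_all2_conv_all_nth)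
    qed
  qed
  then show ?case by simp
qed auto

text \<open>The leaves \<open>p[x_i]\<close> of a right-hand side become related calls; all its
  other labels are output symbols, hence outside \<open>Q\<close>.\<close>

lemma sim_subst:
  assumes "w \<in> trees_over \<Delta> {Node p [Var i] |p i. p \<in> Q \<and> i < k}" and "Q \<inter> symbols \<Delta> = {}"
    and "\<And>i. i < k \<Longrightarrow> H (\<phi> i) (\<phi>' i)"
  shows "sim Q H (subst \<phi> w) (subst \<phi>' w)"
  using assms(1)
proof induction
  case (base t)
  then obtain p i where "t = Node p [Var i]" "p \<in> Q" "i < k" by blast
  then show ?case using sim.call[of p Q H] assms(3) by simp
next
  case (leaf a)
  then show ?case using assms(2) by (auto intro!: sim.node dest: in_symbols)
next
  case (node ts a)
  then show ?case using assms(2)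
    by (auto intro!: sim.node dest: in_symbols simp: list_all2_conv_all_nth)
qed

text \<open>A step can only rewrite a call as a whole: redexes have a state at the root, and
  \<open>irred\<close> excludes steps inside a pending input. It therefore suffices to match single
  calls, which is the assumption \<open>call\<close>.\<close>

lemma sim_step:
  assumes lhs: "\<And>r. r \<in> R1 \<Longrightarrow> \<exists>q ts. lhs r = Node q ts \<and> q \<in> Q"
    and irred: "\<And>s s' v. H s s' \<Longrightarrow> \<not> step R1 s v"
    and call: "\<And>r \<phi> q s s'. r \<in> R1 \<Longrightarrow> (\<And>i. i < length (ranges r) \<Longrightarrow> \<phi> i \<in> ranges r ! i) \<Longrightarrow>
        subst \<phi> (lhs r) = Node q [s] \<Longrightarrow> H s s' \<Longrightarrow>
        \<exists>v'. step R2 (Node q [s']) v' \<and> sim Q H (subst \<phi> (rhs r)) v'"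
    and "sim Q H u u'" "step R1 u v"
  shows "\<exists>v'. step R2 u' v' \<and> sim Q H v v'"
  using assms(4,5)
proof (induction arbitrary: v rule: sim.induct)
  case (call q s s')
  from call.prems show ?case
  proof (cases rule: step_NodeE)
    case (root r \<phi>)
    then show ?thesis using assms(3)[of r \<phi> q s s'] call by simp
  next
    case (inner us t t' vs)
    \<comment> \<open>The only son of a call is \<open>s\<close>, so this step would take place
      inside an input tree.\<close>
    then show ?thesis using irred[OF call.hyps(2)] by (auto simp: Cons_eq_append_conv)
  qed
next
  case (node b us us')
  from node.prems show ?case
  proof (cases rule: step_NodeE)
    case (root r \<phi>)
    then show ?thesis using lhs[of r] node.hyps by auto
  next
    case (inner xs t t' ys)
    then obtain xs' u ys' where us': "us' = xs' @ u # ys'"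
      and xs: "list_all2 (sim Q H) xs xs'" and ys: "list_all2 (sim Q H) ys ys'"
      and IH: "\<And>v. step R1 t v \<Longrightarrow> \<exists>v'. step R2 u v' \<and> sim Q H v v'"
      using node.IH unfolding inner(1) list_all2_append1 list_all2_Cons1
      by (smt (verit, del_insts) list_all2_mono)
    from IH[OF inner(3)] obtain v' where "step R2 u v'" "sim Q H t' v'" by blast
    then show ?thesis
      using xs ys node.hyps unfolding us' inner(2)
      by (intro exI[of _ "Node b (xs' @ v' # ys')"])
        (auto intro!: step.inner sim.node list_all2_appendI)
  qed
qed

text \<open>\<open>sim\<close> is an invariant of the two derivations run in parallel; at the end
  \<open>t\<close> is free of states, so the simulating derivation has arrived at \<open>t\<close>
  itself.\<close>

lemma sim_derivation:
  assumes lhs: "\<And>r. r \<in> R1 \<Longrightarrow> \<exists>q ts. lhs r = Node q ts \<and> q \<in> Q"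
    and irred: "\<And>s s' v. H s s' \<Longrightarrow> \<not> step R1 s v"
    and call: "\<And>r \<phi> q s s'. r \<in> R1 \<Longrightarrow> (\<And>i. i < length (ranges r) \<Longrightarrow> \<phi> i \<in> ranges r ! i) \<Longrightarrow>
        subst \<phi> (lhs r) = Node q [s] \<Longrightarrow> H s s' \<Longrightarrow>
        \<exists>v'. step R2 (Node q [s']) v' \<and> sim Q H (subst \<phi> (rhs r)) v'"
    and steps: "(step R1)\<^sup>*\<^sup>* (Node q [s]) t" and "q \<in> Q" "H s s'" "set_tree t \<inter> Q = {}"
  shows "(step R2)\<^sup>*\<^sup>* (Node q [s']) t"
proof -
  from steps have "\<exists>t'. (step R2)\<^sup>*\<^sup>* (Node q [s']) t' \<and> sim Q H t t'"
  proof (induction rule: rtranclp_induct)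
    case base
    then show ?case using sim.call[of q Q H s s'] assms(5,6) by blast
  next
    case (step u v)
    then obtain u' where u': "(step R2)\<^sup>*\<^sup>* (Node q [s']) u'" "sim Q H u u'" by blast
    have "\<exists>v'. step R2 u' v' \<and> sim Q H v v'"
      by (rule sim_step[OF _ _ _ u'(2) step.hyps(2)]) (fact lhs irred call)+
    then obtain v' where "step R2 u' v'" "sim Q H v v'" by blast
    then show ?case using u'(1) by (meson rtranclp.rtrancl_into_rtrancl)
  qed
  then show ?thesis using sim_eq[of Q H t] assms(7) by auto
qed

section \<open>A common automaton for finitely many recognizable languages\<close>

text \<open>This is the product automaton, with pairs of states coded as numbers so that the state
  type stays \<open>nat\<close> throughout the later induction.\<close>

lemma run_prod:
  assumes \<delta>: "\<And>a qs. \<delta> a qs =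
      prod_encode (\<delta>1 a (map (fst \<circ> prod_decode) qs), \<delta>2 a (map (snd \<circ> prod_decode) qs))"
    and "t \<in> trees \<Sigma>"
  shows "run \<delta> t = prod_encode (run \<delta>1 t, run \<delta>2 t)"
  using assms(2)
proof (induction rule: trees_induct)
  case (Node a ts)
  then have "map (fst \<circ> prod_decode \<circ> run \<delta>) ts = map (run \<delta>1) ts"
    "map (snd \<circ> prod_decode \<circ> run \<delta>) ts = map (run \<delta>2) ts"
    by auto
  then show ?case
    using \<delta>[of a "map (run \<delta>) ts"] by (simp add: comp_assoc del: map_eq_conv)
qed

text \<open>Decoding by \<open>inv e\<close> is correct on the range of \<open>e\<close>, where all
  states reached on trees lie. The renaming serves to turn states into symbols.\<close>

lemma run_rename:
  assumes \<delta>: "\<And>a qs. \<delta> a qs = e (\<delta>0 a (map (inv e) qs))" and "inj e" "t \<in> trees \<Sigma>"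
  shows "run \<delta> t = e (run \<delta>0 t)"
  using assms(3)
proof (induction rule: trees_induct)
  case (Node a ts)
  then have "map (inv e \<circ> run \<delta>) ts = map (run \<delta>0) ts"
    using assms(2) by auto
  then show ?case
    using \<delta>[of a "map (run \<delta>) ts"] by (simp del: map_eq_conv)
qed

text \<open>\<open>L\<close> is a union of classes of the equivalence "same state reached". Speaking
  of classes instead of final states lets one automaton serve many languages.\<close>

definition saturated :: "'a ralphabet \<Rightarrow> ('a \<Rightarrow> 'q list \<Rightarrow> 'q) \<Rightarrow> 'a tree set \<Rightarrow> bool" where
  "saturated \<Sigma> \<delta> L \<longleftrightarrow> L \<subseteq> trees \<Sigma> \<and>
     (\<forall>s \<in> L. \<forall>t \<in> trees \<Sigma>. run \<delta> t = run \<delta> s \<longrightarrow> t \<in> L)"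

lemma recognizable_saturated:
  assumes "recognizable \<Sigma> L"
  obtains \<delta> :: "'a \<Rightarrow> nat list \<Rightarrow> nat"
  where "finite (run \<delta> ` trees (\<Sigma> :: 'a ralphabet))" "saturated \<Sigma> \<delta> L"
proof -
  from assms obtain Q :: "nat set" and F \<delta> where Q: "finite Q" "F \<subseteq> Q"
    "\<forall>a qs. a \<in> \<Sigma> (length qs) \<and> set qs \<subseteq> Q \<longrightarrow> \<delta> a qs \<in> Q"
    and L: "L = {t \<in> trees \<Sigma>. run \<delta> t \<in> F}"
    unfolding recognizable_def by auto
  have "run \<delta> t \<in> Q" if "t \<in> trees \<Sigma>" for t
    using that
  proof (induction rule: trees_induct)
    case (Node a ts)
    then have "set (map (run \<delta>) ts) \<subseteq> Q" by auto
    then show ?case using Q(3) Node.hyps(1) by (metis length_map run.simps(2))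
  qed
  then have "run \<delta> ` trees \<Sigma> \<subseteq> Q" by auto
  then have "finite (run \<delta> ` trees \<Sigma>)" using Q(1) finite_subset by blast
  moreover have "saturated \<Sigma> \<delta> L" unfolding saturated_def L by auto
  ultimately show thesis by (rule that)
qed

text \<open>The product automaton induces an equivalence at least as fine as that of either factor,
  so it saturates whatever one factor saturates.\<close>

lemma common_automaton_nat:
  fixes \<Sigma> :: "'a ralphabet"
  assumes "finite Ls" "\<And>L. L \<in> Ls \<Longrightarrow> recognizable \<Sigma> L"
  shows "\<exists>\<delta> :: 'a \<Rightarrow> nat list \<Rightarrow> nat. finite (run \<delta> ` trees \<Sigma>) \<and> (\<forall>L \<in> Ls. saturated \<Sigma> \<delta> L)"
  using assms
proof (induction rule: finite_induct)
  case empty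
  \<comment> \<open>The empty family still requires an automaton with finitely many reachable
    states; the recognizability of the set of all trees supplies one.\<close>
  obtain \<delta> :: "'a \<Rightarrow> nat list \<Rightarrow> nat" where "finite (run \<delta> ` trees \<Sigma>)"
    by (rule recognizable_saturated[OF recognizable_trees])
  then show ?case by auto
next
  case (insert L Ls)
  then obtain \<delta>1 :: "'a \<Rightarrow> nat list \<Rightarrow> nat"
    where \<delta>1: "finite (run \<delta>1 ` trees \<Sigma>)" "\<forall>L \<in> Ls. saturated \<Sigma> \<delta>1 L" by auto
  have "recognizable \<Sigma> L" using insert.prems by simp
  then obtain \<delta>2 :: "'a \<Rightarrow> nat list \<Rightarrow> nat"
    where \<delta>2: "finite (run \<delta>2 ` trees \<Sigma>)" "saturated \<Sigma> \<delta>2 L" by (rule recognizable_saturated)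
  define \<delta> where "\<delta> = (\<lambda>a qs. prod_encode (\<delta>1 a (map (fst \<circ> prod_decode) qs), \<delta>2 a (map (snd \<circ> prod_decode) qs)))"
  have run: "run \<delta> t = prod_encode (run \<delta>1 t, run \<delta>2 t)" if "t \<in> trees \<Sigma>" for t
    by (rule run_prod[OF _ that]) (simp add: \<delta>_def)
  have "run \<delta> ` trees \<Sigma> \<subseteq> prod_encode ` (run \<delta>1 ` trees \<Sigma> \<times> run \<delta>2 ` trees \<Sigma>)"
    using run by auto
  then have "finite (run \<delta> ` trees \<Sigma>)"
    by (rule finite_subset) (use \<delta>1 \<delta>2 in auto)
  moreover have "saturated \<Sigma> \<delta> K" if "K \<in> insert L Ls" for K
  proof -
    have "saturated \<Sigma> \<delta>1 K \<or> saturated \<Sigma> \<delta>2 K" using that \<delta>1 \<delta>2 by auto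
    then show ?thesis unfolding saturated_def by (metis run prod.inject prod_encode_eq subsetD)
  qed
  ultimately show ?case by blast
qed

text \<open>The states will be rank-one symbols of the relabeling, so they must lie in
  \<open>'a\<close> and avoid a given finite set \<open>A\<close>; the infinite type leaves room for
  that.\<close>

lemma common_automaton:
  fixes \<Sigma> :: "('a::infinite) ralphabet"
  assumes "finite Ls" "\<And>L. L \<in> Ls \<Longrightarrow> recognizable \<Sigma> L" "finite A"
  obtains \<delta> :: "'a \<Rightarrow> 'a list \<Rightarrow> 'a"
  where "finite (run \<delta> ` trees \<Sigma>)" "run \<delta> ` trees \<Sigma> \<inter> A = {}" "\<And>L. L \<in> Ls \<Longrightarrow> saturated \<Sigma> \<delta> L"
proof -
  obtain \<delta>0 :: "'a \<Rightarrow> nat list \<Rightarrow> nat"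
    where \<delta>0: "finite (run \<delta>0 ` trees \<Sigma>)" "\<forall>L \<in> Ls. saturated \<Sigma> \<delta>0 L"
    using common_automaton_nat[of Ls \<Sigma>] assms by blast
  have "infinite (- A)" using assms(3) infinite_UNIV by (simp add: Compl_eq_Diff_UNIV)
  then obtain e :: "nat \<Rightarrow> 'a" where e: "inj e" "range e \<subseteq> - A"
    using infinite_countable_subset by blast
  define \<delta> where "\<delta> = (\<lambda>a qs. e (\<delta>0 a (map (inv e) qs)))"
  have run: "run \<delta> t = e (run \<delta>0 t)" if "t \<in> trees \<Sigma>" for t
    by (rule run_rename[OF _ e(1) that]) (simp add: \<delta>_def)
  show thesis
  proof (rule that)
    have "run \<delta> ` trees \<Sigma> = e ` run \<delta>0 ` trees \<Sigma>" using run by (auto simp: image_iff)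
    then show "finite (run \<delta> ` trees \<Sigma>)" "run \<delta> ` trees \<Sigma> \<inter> A = {}" using \<delta>0(1) e(2) by auto
    show "saturated \<Sigma> \<delta> L" if "L \<in> Ls" for L
      using \<delta>0(2) that run e(1) unfolding saturated_def by (metis injD subsetD)
  qed
qed

section \<open>The relabeling\<close>

text \<open>These pairs index both the new alphabet and the rules of the relabeling, and they carry
  the look-ahead information for the new top-down transducer.\<close>

definition annotations :: "'a ralphabet \<Rightarrow> ('a \<Rightarrow> 'q list \<Rightarrow> 'q) \<Rightarrow> ('a \<times> 'q list) set" where
  "annotations \<Sigma> \<delta> = {(a, ps). a \<in> \<Sigma> (length ps) \<and> set ps \<subseteq> run \<delta> ` trees \<Sigma>}"

lemma finite_annotations:
  assumes "ranked_alphabet \<Sigma>" "finite (run \<delta> ` trees \<Sigma>)"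
  shows "finite (annotations \<Sigma> \<delta>)"
proof -
  have "finite {k. \<Sigma> k \<noteq> {}}" using assms(1) by (simp add: ranked_alphabet_def)
  \<comment> \<open>Only finitely many ranks occur, which bounds the lengths of the state
    lists.\<close>
  then obtain n where n: "\<forall>k \<in> {k. \<Sigma> k \<noteq> {}}. k \<le> n"
    using finite_nat_set_iff_bounded_le by blast
  have "annotations \<Sigma> \<delta> \<subseteq> symbols \<Sigma> \<times> {ps. set ps \<subseteq> run \<delta> ` trees \<Sigma> \<and> length ps \<le> n}"
    using n by (auto simp: annotations_def symbols_def)
  then show ?thesis
    by (rule finite_subset)
      (use assms in \<open>auto simp: ranked_alphabet_def finite_lists_length_le\<close>)
qed

lemma ex_inj_on_into_infinite:
  assumes "finite W" "infinite B"
  obtains f where "inj_on f W" "f ` W \<subseteq> B"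
proof -
  obtain C where "C \<subseteq> B" "finite C" "card C = card W"
    using infinite_arbitrarily_large[OF assms(2)] by metis
  then obtain f where "bij_betw f W C" using assms(1) finite_same_card_bij by metis
  then show thesis using that \<open>C \<subseteq> B\<close> by (auto simp: bij_betw_def)
qed

text \<open>
  \<open>enc (a, ps)\<close> is the new label of a node with label \<open>a\<close> at whose sons the states \<open>ps\<close> are reached.
\<close>

locale relabeling =
  fixes \<Sigma> :: "'a ralphabet" and \<delta> :: "'a \<Rightarrow> 'a list \<Rightarrow> 'a" and enc :: "'a \<times> 'a list \<Rightarrow> 'a"
  assumes ranked: "ranked_alphabet \<Sigma>"
    and finite_states: "finite (run \<delta> ` trees \<Sigma>)"
    and states_fresh: "run \<delta> ` trees \<Sigma> \<inter> symbols \<Sigma> = {}"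
    and inj_enc: "inj_on enc (annotations \<Sigma> \<delta>)"
    and enc_fresh: "enc ` annotations \<Sigma> \<delta> \<inter> (symbols \<Sigma> \<union> run \<delta> ` trees \<Sigma>) = {}"
begin

abbreviation P :: "'a set" where "P \<equiv> run \<delta> ` trees \<Sigma>"

abbreviation W :: "('a \<times> 'a list) set" where "W \<equiv> annotations \<Sigma> \<delta>"

text \<open>By injectivity of \<open>enc\<close> on \<open>W\<close>, a new symbol has exactly one
  rank, even if the old symbol has several.\<close>

definition \<Gamma> :: "'a ralphabet" where
  "\<Gamma> k = enc ` {(a, ps) \<in> W. length ps = k}"

primrec relabel :: "'a tree \<Rightarrow> 'a tree" where
  "relabel (Var i) = Var i"
| "relabel (Node a ts) = Node (enc (a, map (run \<delta>) ts)) (map relabel ts)"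

lemma symbols_\<Gamma>: "symbols \<Gamma> = enc ` W"
  by (auto simp: symbols_def \<Gamma>_def)

lemma ranked_\<Gamma>: "ranked_alphabet \<Gamma>"
proof -
  have "{k. \<Gamma> k \<noteq> {}} \<subseteq> {k. \<Sigma> k \<noteq> {}}" by (auto simp: \<Gamma>_def annotations_def)
  then show ?thesis
    using ranked finite_annotations[OF ranked finite_states]
    by (auto simp: ranked_alphabet_def symbols_\<Gamma> intro: finite_subset)
qed

lemma annotation_in: "a \<in> \<Sigma> (length ts) \<Longrightarrow> set ts \<subseteq> trees \<Sigma> \<Longrightarrow> (a, map (run \<delta>) ts) \<in> W"
  by (auto simp: annotations_def)

lemma relabel_in: "t \<in> trees \<Sigma> \<Longrightarrow> relabel t \<in> trees \<Gamma>"
proof (induction rule: trees_induct)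
  case (Node a ts)
  then show ?case using annotation_in[of a ts] by (auto simp: \<Gamma>_def)
qed

text \<open>Each state in \<open>ps\<close> is reached by some tree; placing such trees below
  \<open>a\<close> gives a tree that reaches \<open>\<delta> a ps\<close>.\<close>

lemma transition_in: "(a, ps) \<in> W \<Longrightarrow> \<delta> a ps \<in> P"
proof -
  assume W: "(a, ps) \<in> W"
  then have "ps \<in> lists P" by (auto simp: annotations_def)
  then obtain ts where "ps = map (run \<delta>) ts" "set ts \<subseteq> trees \<Sigma>"
    unfolding lists_image by auto
  then show ?thesis using W
    by (intro image_eqI[of _ _ "Node a ts"]) (auto simp: annotations_def)
qed

section \<open>The bottom-up transducer of the relabeling\<close>

definition brule :: "'a \<times> 'a list \<Rightarrow> 'a rule" where
  "brule = (\<lambda>(a, ps). \<lparr>lhs = Node a (map (\<lambda>i. Node (ps ! i) [Var i]) [0..<length ps]),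
     rhs = Node (\<delta> a ps) [Node (enc (a, ps)) (map Var [0..<length ps])],
     ranges = replicate (length ps) (trees \<Gamma>)\<rparr>)"

text \<open>The left-hand side displays \<open>a\<close> at its root and \<open>ps\<close> at the
  sons; this yields the determinism of the relabeling.\<close>

lemma brule_lhs_inj:
  assumes "lhs (brule (a, ps)) = lhs (brule (b, qs))"
  shows "a = b \<and> ps = qs"
proof -
  let ?sons = "\<lambda>ps. map (\<lambda>i. Node (ps ! i) [Var i]) [0..<length ps]"
  have "a = b" and sons: "?sons ps = ?sons qs" using assms by (auto simp: brule_def)
  have len: "length ps = length qs" using arg_cong[OF sons, of length] by simp
  moreover have "ps ! i = qs ! i" if "i < length ps" for i
    using arg_cong[OF sons, of "\<lambda>ts. ts ! i"] that len by simp
  ultimately show ?thesis using \<open>a = b\<close> nth_equalityI by blast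
qed

text \<open>Every state is final, since each input tree has to be relabeled whatever state it
  reaches.\<close>

definition B :: "'a transducer" where
  "B = \<lparr>states = P, inp = \<Sigma>, out = \<Gamma>, rules = brule ` W, designated = P\<rparr>"

lemma dbqrel_B: "dbqrel B"
proof -
  have "dbqrel_rule P \<Sigma> \<Gamma> (brule (a, ps))" if "(a, ps) \<in> W" for a ps
    using that transition_in[OF that] unfolding dbqrel_rule_def
    by (intro exI[of _ a] exI[of _ "enc (a, ps)"] exI[of _ "\<delta> a ps"] exI[of _ "length ps"] exI[of _ ps])
      (auto simp: brule_def \<Gamma>_def annotations_def)
  moreover have "distinct_lhs (brule ` W)"
    using brule_lhs_inj by (fastforce simp: distinct_lhs_def)
  moreover have "finite W" using finite_annotations[OF ranked finite_states] .
  ultimately show ?thesis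
    using ranked ranked_\<Gamma> finite_states states_fresh enc_fresh
    by (auto simp: dbqrel_def transducer_base_def B_def symbols_\<Gamma>)
qed

lemma relabel_steps:
  "t \<in> trees \<Sigma> \<Longrightarrow> (step (brule ` W))\<^sup>*\<^sup>* t (Node (run \<delta> t) [relabel t])"
proof (induction rule: trees_induct)
  case (Node a ts)
  let ?ps = "map (run \<delta>) ts" and ?\<phi> = "\<lambda>i. relabel (ts ! i)"
  have "list_all2 (step (brule ` W))\<^sup>*\<^sup>* ts (map (\<lambda>t. Node (run \<delta> t) [relabel t]) ts)"
    using Node.IH by (simp add: list_all2_conv_all_nth)
  then have steps: "(step (brule ` W))\<^sup>*\<^sup>* (Node a ts) (Node a (map (\<lambda>t. Node (run \<delta> t) [relabel t]) ts))"
    by (rule steps_sons[where vs = "[]", unfolded append_Nil])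
  \<comment> \<open>Once the sons are processed, the states above them select the rule of the
    annotation \<open>(a, ?ps)\<close>.\<close>
  have step: "step (brule ` W) (subst ?\<phi> (lhs (brule (a, ?ps)))) (subst ?\<phi> (rhs (brule (a, ?ps))))"
    using annotation_in[OF Node.hyps] Node.hyps
    by (intro step.root imageI) (auto simp: brule_def intro!: relabel_in)
  have lhs: "subst ?\<phi> (lhs (brule (a, ?ps))) = Node a (map (\<lambda>t. Node (run \<delta> t) [relabel t]) ts)"
    by (auto simp: brule_def intro!: nth_equalityI)
  have rhs: "subst ?\<phi> (rhs (brule (a, ?ps))) = Node (run \<delta> (Node a ts)) [relabel (Node a ts)]"
    by (auto simp: brule_def intro!: nth_equalityI)
  from steps step[unfolded lhs rhs] show ?case by (rule rtranclp.rtrancl_into_rtrancl)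
qed

text \<open>This is the invariant of derivations from \<open>t\<close>: some disjoint subtrees are
  finished, each turned into its state above its relabeled version, while the nodes above them keep
  their old labels.\<close>

inductive partial :: "'a tree \<Rightarrow> 'a tree \<Rightarrow> bool" where
  reached: "partial t (Node (run \<delta> t) [relabel t])"
| pending: "list_all2 partial ts us \<Longrightarrow> partial (Node a ts) (Node a us)"

lemma partial_refl: "t \<in> trees \<Sigma> \<Longrightarrow> partial t t"
  by (induction rule: trees_induct) (auto intro!: pending simp: list_all2_conv_all_nth)

text \<open>An unfinished root would make \<open>p\<close> an input symbol, but states are disjoint
  from these.\<close>

lemma partial_state:
  assumes "partial t (Node p [u])" "t \<in> trees \<Sigma>" "p \<in> P"
  shows "p = run \<delta> t \<and> u = relabel t"
  using assms(1)
proof cases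
  case (pending ts)
  then show ?thesis using assms(2,3) states_fresh by (auto simp: symbols_def)
qed auto

lemma partial_step:
  assumes "step (brule ` W) u v" "partial t u" "t \<in> trees \<Sigma>"
  shows "partial t v"
  using assms
proof (induction arbitrary: t rule: step.induct)
  case (root r \<phi>)
  then obtain a ps where W: "(a, ps) \<in> W" and r: "r = brule (a, ps)" by auto
  have a: "a \<in> symbols \<Sigma>" using W by (auto simp: annotations_def symbols_def)
  from root.prems(1) show ?case
  proof cases
    case reached
    \<comment> \<open>A finished tree has a state at its root, whereas a redex has the input symbol
      \<open>a\<close> there.\<close>
    then show ?thesis using a states_fresh root.prems(2) by (auto simp: r brule_def)
  next
    case (pending ts us b)
    then have b: "b = a" and us: "us = map (\<lambda>i. Node (ps ! i) [\<phi> i]) [0..<length ps]"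
      by (auto simp: r brule_def)
    have len: "length ts = length ps" using pending(3) by (simp add: us list_all2_conv_all_nth)
    \<comment> \<open>The redex shows a state on top of every son, so all sons are finished and the
      rule computes the correct state and label.\<close>
    have "ps ! i = run \<delta> (ts ! i) \<and> \<phi> i = relabel (ts ! i)" if "i < length ps" for i
    proof (rule partial_state)
      show "partial (ts ! i) (Node (ps ! i) [\<phi> i])"
        using pending(3) that by (auto simp: us list_all2_conv_all_nth)
      show "ts ! i \<in> trees \<Sigma>" using root.prems(2) that len by (auto simp: pending(1))
      show "ps ! i \<in> P" using W that by (auto simp: annotations_def)
    qed
    then have "map (run \<delta>) ts = ps" "map \<phi> [0..<length ps] = map relabel ts"
      using len by (auto intro!: nth_equalityI)
    then have "subst \<phi> (rhs r) = Node (run \<delta> t) [relabel t]"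
      by (simp add: r brule_def pending(1) b comp_def)
    then show ?thesis using reached by simp
  qed
next
  case (inner u v a us vs)
  from inner.prems(1) show ?case
  proof cases
    case reached
    \<comment> \<open>Redexes are rooted in input symbols, and a relabeled tree contains only
      symbols from the image of \<open>enc\<close>.\<close>
    have "\<not> step (brule ` W) (relabel t) v"
    proof (rule irreducible[where Q = "symbols \<Sigma>"])
      show "set_tree (relabel t) \<inter> symbols \<Sigma> = {}"
        using labels_trees[OF relabel_in[OF inner.prems(2)]] enc_fresh by (auto simp: symbols_\<Gamma>)
    qed (auto simp: brule_def annotations_def symbols_def)
    then show ?thesis using reached inner.hyps by (auto simp: append_eq_Cons_conv)
  next
    case (pending ts)
    then obtain xs s ys where ts: "ts = xs @ s # ys"
      and "list_all2 partial xs us" "partial s u" "list_all2 partial ys vs"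
      by (auto simp: list_all2_append2 list_all2_Cons2)
    moreover have "s \<in> trees \<Sigma>" using inner.prems(2) by (auto simp: pending(1) ts)
    ultimately show ?thesis
      using inner.IH unfolding pending(1) ts by (auto intro!: partial.pending list_all2_appendI)
  qed
qed

text \<open>\<open>relabel_steps\<close> provides a derivation to \<open>relabel s\<close>, and the
  invariant \<open>partial\<close> excludes any other result.\<close>

lemma bottomup_transformation_B:
  "bottomup_transformation B = (\<Sigma>, \<Gamma>, {(s, relabel s) |s. s \<in> trees \<Sigma>})"
proof -
  have "t = relabel s"
    if "s \<in> trees \<Sigma>" "p \<in> P" "(step (brule ` W))\<^sup>*\<^sup>* s (Node p [t])" for s t p
  proof -
    from that(3) have "partial s (Node p [t])"
      by (induction rule: rtranclp_induct) (use that(1) partial_refl partial_step in auto)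
    then show ?thesis using partial_state that by blast
  qed
  then show ?thesis
    using relabel_steps relabel_in by (auto simp: bottomup_transformation_def B_def) blast+
qed

end

section \<open>The top-down transducer on relabeled trees\<close>

text \<open>The new transducer keeps the states of \<open>M\<close> but reads the new alphabet,
  whence the freshness assumption \<open>states_M_fresh\<close>.\<close>

locale look_ahead = relabeling \<Sigma> \<delta> enc
  for \<Sigma> :: "'a ralphabet" and \<delta> enc +
  fixes M :: "'a transducer"
  assumes topdown_la_M: "topdown_la M"
    and inp_M: "inp M = \<Sigma>"
    and saturated_ranges: "\<And>r L. r \<in> rules M \<Longrightarrow> L \<in> set (ranges r) \<Longrightarrow> saturated \<Sigma> \<delta> L"
    and states_M_fresh: "states M \<inter> enc ` annotations \<Sigma> \<delta> = {}"
begin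

abbreviation Q :: "'a set" where "Q \<equiv> states M"

definition trule :: "'a \<Rightarrow> 'a \<times> 'a list \<Rightarrow> 'a rule \<Rightarrow> 'a rule" where
  "trule q ap r = \<lparr>lhs = Node q [Node (enc ap) (map Var [0..<length (snd ap)])],
     rhs = rhs r, ranges = replicate (length (snd ap)) (trees \<Gamma>)\<rparr>"

text \<open>The last conjunct is the look-ahead test: some tree in the range reaches the annotated
  state, and by saturation every tree reaching it then lies in the range. The length conditions fix
  the rank, since \<open>fst ap\<close> may have several; the condition on \<open>rhs r\<close> ties
  its variables to that rank.\<close>

definition fits :: "'a \<Rightarrow> 'a \<times> 'a list \<Rightarrow> 'a rule \<Rightarrow> bool" where
  "fits q ap r \<longleftrightarrow> q \<in> Q \<and> ap \<in> W \<and> r \<in> rules M \<and>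
     lhs r = Node q [Node (fst ap) (map Var [0..<length (snd ap)])] \<and>
     rhs r \<in> trees_over (out M) {Node p [Var i] |p i. p \<in> Q \<and> i < length (snd ap)} \<and>
     length (ranges r) = length (snd ap) \<and>
     (\<forall>i < length (snd ap). snd ap ! i \<in> run \<delta> ` (ranges r ! i))"

definition N :: "'a transducer" where
  "N = \<lparr>states = Q, inp = \<Gamma>, out = out M, rules = {trule q ap r |q ap r. fits q ap r},
     designated = designated M\<rparr>"

lemma base_M: "transducer_base M"
  using topdown_la_M by (simp add: topdown_la_def)

lemma rule_M:
  assumes "r \<in> rules M"
  obtains q a k where "q \<in> Q" "a \<in> \<Sigma> k" "lhs r = Node q [Node a (map Var [0..<k])]"
    "rhs r \<in> trees_over (out M) {Node p [Var i] |p i. p \<in> Q \<and> i < k}" "length (ranges r) = k"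
  using assms topdown_la_M unfolding topdown_la_def topdown_la_rule_def inp_M by blast

lemma topdown_N: "topdown N"
proof -
  have "rules N \<subseteq> (\<lambda>(q, ap, r). trule q ap r) ` (Q \<times> W \<times> rules M)"
    by (auto simp: N_def fits_def image_def)
  then have "finite (rules N)"
    by (rule finite_subset)
      (use base_M finite_annotations[OF ranked finite_states] in \<open>auto simp: transducer_base_def\<close>)
  then have "transducer_base N"
    using base_M ranked_\<Gamma> states_M_fresh by (auto simp: transducer_base_def N_def symbols_\<Gamma>)
  moreover have "topdown_la_rule Q \<Gamma> (out M) (trule q ap r)" if "fits q ap r" for q ap r
    using that recognizable_trees[of \<Gamma>] unfolding topdown_la_rule_def
    by (intro exI[of _ q] exI[of _ "enc ap"] exI[of _ "length (snd ap)"])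
      (auto simp: fits_def trule_def \<Gamma>_def)
  ultimately show ?thesis
    by (auto simp: topdown_def topdown_la_def N_def trule_def)
qed

lemma linear_N: "linear M \<Longrightarrow> linear N"
  by (auto simp: linear_def N_def trule_def fits_def)

text \<open>Equal left-hand sides come from the same state and annotation. If two different rules of
  \<open>M\<close> fitted them, each annotated state would be reached in both corresponding ranges,
  and saturation would give these a common tree.\<close>

lemma deterministic_N:
  assumes "deterministic_la M"
  shows "deterministic N"
proof -
  have "trule q1 ap1 r1 = trule q2 ap2 r2"
    if fits: "fits q1 ap1 r1" "fits q2 ap2 r2"
      and lhs: "lhs (trule q1 ap1 r1) = lhs (trule q2 ap2 r2)"
    for q1 ap1 r1 q2 ap2 r2
  proof -
    have q: "q1 = q2" and ap: "ap1 = ap2"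
      using fits lhs inj_enc by (auto simp: trule_def fits_def dest: inj_onD)
    have r: "r1 \<in> rules M" "r2 \<in> rules M" "lhs r1 = lhs r2"
      using fits by (simp_all add: fits_def q ap)
    have "r1 = r2"
    proof (rule ccontr)
      assume "r1 \<noteq> r2"
      then obtain i where i: "i < length (ranges r1)" "ranges r1 ! i \<inter> ranges r2 ! i = {}"
        using assms r unfolding deterministic_la_def by blast
      then have "i < length (snd ap2)" using fits(1) by (simp add: fits_def ap)
      then have "snd ap2 ! i \<in> run \<delta> ` (ranges r1 ! i)" "snd ap2 ! i \<in> run \<delta> ` (ranges r2 ! i)"
        using fits by (auto simp: fits_def ap)
      then obtain s1 s2 where s: "s1 \<in> ranges r1 ! i" "s2 \<in> ranges r2 ! i" "run \<delta> s1 = run \<delta> s2"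
        unfolding image_iff by metis
      have "i < length (ranges r2)" using i fits by (simp add: fits_def ap)
      then have "saturated \<Sigma> \<delta> (ranges r1 ! i)" "saturated \<Sigma> \<delta> (ranges r2 ! i)"
        using saturated_ranges r(1,2) i(1) by auto
      then have "s2 \<in> ranges r1 ! i" using s unfolding saturated_def by (metis subsetD)
      then show False using i(2) s(2) by blast
    qed
    then show ?thesis using q ap by simp
  qed
  then show ?thesis
    using assms unfolding deterministic_def deterministic_la_def distinct_lhs_def N_def by auto
qed

section \<open>Agreement of derivations before and after relabeling\<close>

abbreviation H :: "'a tree \<Rightarrow> 'a tree \<Rightarrow> bool" where
  "H s s' \<equiv> s \<in> trees \<Sigma> \<and> s' = relabel s"

lemma out_fresh: "Q \<inter> symbols (out M) = {}"
  using base_M by (simp add: transducer_base_def)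

lemma simulates_M:
  assumes "(step (rules M))\<^sup>*\<^sup>* (Node q [s]) t" "q \<in> Q" "s \<in> trees \<Sigma>" "t \<in> trees (out M)"
  shows "(step (rules N))\<^sup>*\<^sup>* (Node q [relabel s]) t"
proof (rule sim_derivation[OF _ _ _ assms(1), where Q = Q and H = H])
  show "\<exists>q ts. lhs r = Node q ts \<and> q \<in> Q" if "r \<in> rules M" for r
    using rule_M[OF that] by metis
  show "\<not> step (rules M) s v" if "H s s'" for s s' v
  proof (rule irreducible[where Q = Q])
    show "\<exists>q ts. lhs r = Node q ts \<and> q \<in> Q" if "r \<in> rules M" for r
      using rule_M[OF that] by metis
    show "set_tree s \<inter> Q = {}"
      using labels_trees[of s \<Sigma>] that base_M by (auto simp: transducer_base_def inp_M)
  qed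
  show "set_tree t \<inter> Q = {}" using labels_trees[OF assms(4)] out_fresh by auto
  fix r \<phi> p s s'
  assume r: "r \<in> rules M" and \<phi>: "\<And>i. i < length (ranges r) \<Longrightarrow> \<phi> i \<in> ranges r ! i"
    and redex: "subst \<phi> (lhs r) = Node p [s]" and H: "H s s'"
  obtain q a k where rule: "q \<in> Q" "a \<in> \<Sigma> k" "lhs r = Node q [Node a (map Var [0..<k])]"
    "rhs r \<in> trees_over (out M) {Node p [Var i] |p i. p \<in> Q \<and> i < k}" "length (ranges r) = k"
    using rule_M[OF r] .
  \<comment> \<open>These are the states reached at the sons of the redex, hence exactly those
    recorded in the new label.\<close>
  define ps where "ps = map (run \<delta> \<circ> \<phi>) [0..<k]"
  have s: "s = Node a (map \<phi> [0..<k])" and p: "p = q" using redex rule(3) by auto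
  have \<phi>_in: "\<phi> i \<in> trees \<Sigma>" if "i < k" for i using H s that by auto
  \<comment> \<open>The subtree \<open>\<phi> i\<close> itself witnesses that its state is reached
    within the \<open>i\<close>-th range.\<close>
  have "fits q (a, ps) r"
    using rule r \<phi> \<phi>_in by (auto simp: fits_def ps_def annotations_def)
  then have "trule q (a, ps) r \<in> rules N" by (auto simp: N_def)
  then have "step (rules N) (subst (relabel \<circ> \<phi>) (lhs (trule q (a, ps) r)))
      (subst (relabel \<circ> \<phi>) (rhs (trule q (a, ps) r)))"
    by (rule step.root) (auto simp: trule_def ps_def \<phi>_in intro!: relabel_in)
  moreover have "subst (relabel \<circ> \<phi>) (lhs (trule q (a, ps) r)) = Node p [s']"
    using H by (auto simp: trule_def ps_def s p)
  moreover have "sim Q H (subst \<phi> (rhs r)) (subst (relabel \<circ> \<phi>) (rhs (trule q (a, ps) r)))"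
    using sim_subst[OF rule(4) out_fresh, of H \<phi> "relabel \<circ> \<phi>"] \<phi>_in by (simp add: trule_def)
  ultimately show "\<exists>v'. step (rules N) (Node p [s']) v' \<and> sim Q H (subst \<phi> (rhs r)) v'" by auto
qed (use assms in auto)

text \<open>This is the same simulation with \<open>H\<close> reversed. The new label reveals the
  old symbol and the states at the sons, and saturation turns the test made by \<open>fits\<close>
  into membership of the actual sons in the ranges.\<close>

lemma simulated_by_M:
  assumes "(step (rules N))\<^sup>*\<^sup>* (Node q [relabel s]) t" "q \<in> Q" "s \<in> trees \<Sigma>" "t \<in> trees (out M)"
  shows "(step (rules M))\<^sup>*\<^sup>* (Node q [s]) t"
proof (rule sim_derivation[OF _ _ _ assms(1), where Q = Q and H = "H\<inverse>\<inverse>"])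
  have lhs_N: "\<exists>q ts. lhs r = Node q ts \<and> q \<in> Q" if "r \<in> rules N" for r
    using that by (auto simp: N_def trule_def fits_def)
  then show "\<exists>q ts. lhs r = Node q ts \<and> q \<in> Q" if "r \<in> rules N" for r
    using that by blast
  show "\<not> step (rules N) s' v" if "H\<inverse>\<inverse> s' s" for s s' v
  proof (rule irreducible[where Q = Q])
    show "set_tree s' \<inter> Q = {}"
      using labels_trees[OF relabel_in[of s]] that states_M_fresh by (auto simp: symbols_\<Gamma>)
  qed (use lhs_N in auto)
  show "set_tree t \<inter> Q = {}" using labels_trees[OF assms(4)] out_fresh by auto
  fix r' \<phi>' p s s'
  assume r': "r' \<in> rules N" and redex: "subst \<phi>' (lhs r') = Node p [s']" and H: "H\<inverse>\<inverse> s' s"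
  obtain q a ps r where fits: "fits q (a, ps) r" and r'_eq: "r' = trule q (a, ps) r"
    using r' by (auto simp: N_def)
  have s': "s' = Node (enc (a, ps)) (map \<phi>' [0..<length ps])" and p: "p = q"
    using redex by (auto simp: r'_eq trule_def)
  obtain b ts where s: "s = Node b ts" and ts: "b \<in> \<Sigma> (length ts)" "set ts \<subseteq> trees \<Sigma>"
    using H by (cases s) auto
  \<comment> \<open>Both pairs lie in \<open>W\<close> and have the same code, so injectivity of
    \<open>enc\<close> identifies them.\<close>
  have "(b, map (run \<delta>) ts) = (a, ps)"
    using H s' s fits annotation_in[OF ts] inj_enc by (auto simp: fits_def dest: inj_onD)
  then have b: "b = a" and ps: "ps = map (run \<delta>) ts" by auto
  have \<phi>': "\<phi>' i = relabel (ts ! i)" if "i < length ts" for i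
  proof -
    have "map relabel ts = map \<phi>' [0..<length ts]" using H s' s ps by simp
    then show ?thesis using that by (metis add_0 length_map length_upt minus_nat.diff_0 nth_map nth_upt)
  qed
  have ranges: "ts ! i \<in> ranges r ! i" if "i < length (ranges r)" for i
  proof -
    have i: "i < length ts" using that fits by (simp add: fits_def ps)
    then have "run \<delta> (ts ! i) \<in> run \<delta> ` (ranges r ! i)" using fits by (auto simp: fits_def ps)
    moreover have "saturated \<Sigma> \<delta> (ranges r ! i)"
      using saturated_ranges[of r] fits that by (simp add: fits_def)
    moreover have "ts ! i \<in> trees \<Sigma>" using ts(2) i by auto
    ultimately show ?thesis unfolding saturated_def by auto
  qed
  \<comment> \<open>The substitution that inserts the original sons matches the rule of
    \<open>M\<close>.\<close>
  have "step (rules M) (subst ((!) ts) (lhs r)) (subst ((!) ts) (rhs r))"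
    using fits ranges by (intro step.root) (auto simp: fits_def)
  moreover have "subst ((!) ts) (lhs r) = Node p [s]"
    using fits by (auto simp: fits_def s p b ps intro!: nth_equalityI)
  moreover have "sim Q H\<inverse>\<inverse> (subst \<phi>' (rhs r)) (subst ((!) ts) (rhs r))"
  proof (rule sim_subst[OF _ out_fresh])
    show "rhs r \<in> trees_over (out M) {Node p [Var i] |p i. p \<in> Q \<and> i < length ts}"
      using fits by (simp add: fits_def ps)
  qed (use ts(2) \<phi>' in auto)
  ultimately show "\<exists>v'. step (rules M) (Node p [s]) v' \<and> sim Q H\<inverse>\<inverse> (subst \<phi>' (rhs r')) v'"
    by (auto simp: r'_eq trule_def)
qed (use assms in auto)

text \<open>The relabeling is a total function on the input trees, so composing with it means
  starting the second transducer on \<open>relabel s\<close>.\<close>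

lemma transformation_M_decomposition:
  obtains M1 M2 where "bottomup_transformation B = (\<Sigma>, \<Gamma>, M1)"
    "topdown_transformation N = (\<Gamma>, out M, M2)"
    "topdown_transformation M = (\<Sigma>, out M, M1 O M2)"
proof
  have "q \<in> Q" if "q \<in> designated M" for q
    using that base_M by (auto simp: transducer_base_def)
  then have steps_iff: "(step (rules N))\<^sup>*\<^sup>* (Node q [relabel s]) t \<longleftrightarrow> (step (rules M))\<^sup>*\<^sup>* (Node q [s]) t"
    if "q \<in> designated M" "s \<in> trees \<Sigma>" "t \<in> trees (out M)" for q s t
    using that simulates_M simulated_by_M by blast
  show "bottomup_transformation B = (\<Sigma>, \<Gamma>, {(s, relabel s) |s. s \<in> trees \<Sigma>})"
    by (rule bottomup_transformation_B)
  show "topdown_transformation N = (\<Gamma>, out M, {(s, t). s \<in> trees \<Gamma> \<and> t \<in> trees (out M) \<and>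
      (\<exists>q \<in> designated M. (step (rules N))\<^sup>*\<^sup>* (Node q [s]) t)})"
    by (simp add: topdown_transformation_def N_def)
  show "topdown_transformation M = (\<Sigma>, out M, {(s, relabel s) |s. s \<in> trees \<Sigma>} O
      {(s, t). s \<in> trees \<Gamma> \<and> t \<in> trees (out M) \<and>
        (\<exists>q \<in> designated M. (step (rules N))\<^sup>*\<^sup>* (Node q [s]) t)})"
    by (auto simp: topdown_transformation_def inp_M relcomp_unfold relabel_in steps_iff)
qed

end

section \<open>Choice of fresh symbols and assembly\<close>

lemma topdown_la_decomposition:
  fixes M :: "('a::infinite) transducer"
  assumes "topdown_la M"
  obtains N \<Gamma> M1 M2 where "topdown N" "linear M \<Longrightarrow> linear N" "deterministic_la M \<Longrightarrow> deterministic N"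
    "(inp M, \<Gamma>, M1) \<in> DBQREL" "topdown_transformation N = (\<Gamma>, out M, M2)"
    "topdown_transformation M = (inp M, out M, M1 O M2)"
proof -
  let ?\<Sigma> = "inp M" and ?Ls = "\<Union>r \<in> rules M. set (ranges r)"
  have base: "transducer_base M" and recog: "\<And>L. L \<in> ?Ls \<Longrightarrow> recognizable ?\<Sigma> L"
    using assms by (auto simp: topdown_la_def topdown_la_rule_def)
  have ranked: "ranked_alphabet ?\<Sigma>" and fin: "finite (symbols ?\<Sigma>)" "finite ?Ls" "finite (states M)"
    using base by (auto simp: transducer_base_def ranked_alphabet_def)
  \<comment> \<open>The automaton is chosen first, with states outside the input alphabet; the codes
    of annotations come afterwards, because they must avoid these states as well.\<close>
  obtain \<delta> :: "'a \<Rightarrow> 'a list \<Rightarrow> 'a" where \<delta>: "finite (run \<delta> ` trees ?\<Sigma>)"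
    "run \<delta> ` trees ?\<Sigma> \<inter> symbols ?\<Sigma> = {}" "\<And>L. L \<in> ?Ls \<Longrightarrow> saturated ?\<Sigma> \<delta> L"
    using common_automaton[OF fin(2) recog fin(1)] by metis
  have "infinite (- (symbols ?\<Sigma> \<union> run \<delta> ` trees ?\<Sigma> \<union> states M))"
    using fin \<delta>(1) infinite_UNIV by (metis finite_Un finite_compl double_complement)
  then obtain enc where enc: "inj_on enc (annotations ?\<Sigma> \<delta>)"
    "enc ` annotations ?\<Sigma> \<delta> \<subseteq> - (symbols ?\<Sigma> \<union> run \<delta> ` trees ?\<Sigma> \<union> states M)"
    using ex_inj_on_into_infinite[OF finite_annotations[OF ranked \<delta>(1)]] by metis
  interpret look_ahead ?\<Sigma> \<delta> enc M
    by unfold_locales (use ranked \<delta> enc assms in auto)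
  obtain M1 M2 where "bottomup_transformation B = (?\<Sigma>, \<Gamma>, M1)"
    "topdown_transformation N = (\<Gamma>, out M, M2)"
    "topdown_transformation M = (?\<Sigma>, out M, M1 O M2)"
    by (rule transformation_M_decomposition)
  then show thesis
    using that[OF topdown_N linear_N deterministic_N] dbqrel_B unfolding DBQREL_def
    by (metis (mono_tags, lifting) mem_Collect_eq)
qed

theorem theorem4p77:
  shows "(T_la :: 'a::infinite transformation set) \<subseteq> DBQREL \<circ>\<^sub>C T \<and>
         (LT_la :: 'a transformation set) \<subseteq> DBQREL \<circ>\<^sub>C LT \<and>
         (DT_la :: 'a transformation set) \<subseteq> DBQREL \<circ>\<^sub>C DT \<and>
         (LDT_la :: 'a transformation set) \<subseteq> DBQREL \<circ>\<^sub>C LDT"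
proof -
  \<comment> \<open>The implications allow one \<open>N\<close> per \<open>M\<close> to serve all
    four inclusions.\<close>
  have "topdown_transformation M \<in> DBQREL \<circ>\<^sub>C {topdown_transformation N |N. topdown N \<and>
      (linear M \<longrightarrow> linear N) \<and> (deterministic_la M \<longrightarrow> deterministic N)}"
    if "topdown_la M" for M :: "'a transducer"
    using topdown_la_decomposition[OF that] unfolding class_comp_def
    by (smt (verit, ccfv_threshold) mem_Collect_eq)
  then show ?thesis
    unfolding T_la_def LT_la_def DT_la_def LDT_la_def T_def LT_def DT_def LDT_def class_comp_def
    by (intro conjI subsetI) (clarsimp, fastforce)+
qed

end
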